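(* Let $M$ be a matroid that is nearly finitary and nearly cofinitary. Then $\big((M^{\mathrm{fin}})^*\vee M\big)^*$ is a matroid.
   Context: Matroids (possibly infinite) satisfy: $\emptyset$ independent; subsets of independent sets are independent; if $B$ is maximal independent and $A$ is non-maximal independent, then $A\cup\{b\}$ is independent for some $b\in B\setminus A$; for independent $A\subseteq X\subseteq E$ there is a maximal independent set $S$ with $A\subseteq S\subseteq X$. Bases are maximal independent sets. The dual $M^*$ has as independent sets the subsets of complements of bases of $M$. The finitarization $M^{\mathrm{fin}}$ has as independent sets those sets all of whose finite subsets are independent in $M$ (it is a matroid). $M$ is nearly finitary if $F\setminus B$ is finite whenever a base $F$ of $M^{\mathrm{fin}}$ contains a base $B$ of $M$; $M$ is nearly cofinitary if $M^*$ is nearly finitary. The union $A\vee B$ has ground set $E(A)\cup E(B)$ and independent sets $\{S\cup T: S$ independent in $A$, $T$ independent in $B\}$. *)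

theory Defs
  imports Main
begin

type_synonym 'a setsys = "'a set \<times> 'a set set"

definition gset :: "'a setsys \<Rightarrow> 'a set" where "gset M = fst M"
definition indep :: "'a setsys \<Rightarrow> 'a set \<Rightarrow> bool" where "indep M X \<longleftrightarrow> X \<in> snd M"

definition maximal_indep :: "'a setsys \<Rightarrow> 'a set \<Rightarrow> bool" where
  "maximal_indep M B \<longleftrightarrow> indep M B \<and> (\<forall>X. indep M X \<longrightarrow> B \<subseteq> X \<longrightarrow> X = B)"

definition basis :: "'a setsys \<Rightarrow> 'a set \<Rightarrow> bool" where
  "basis M B \<longleftrightarrow> maximal_indep M B"

definition maximal_indep_in :: "'a setsys \<Rightarrow> 'a set \<Rightarrow> 'a set \<Rightarrow> bool" where
  "maximal_indep_in M X S \<longleftrightarrow> S \<subseteq> X \<and> indep M S \<and>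
     (\<forall>T. indep M T \<longrightarrow> S \<subseteq> T \<longrightarrow> T \<subseteq> X \<longrightarrow> T = S)"

definition matroid :: "'a setsys \<Rightarrow> bool" where
  "matroid M \<longleftrightarrow>
     (\<forall>X. indep M X \<longrightarrow> X \<subseteq> gset M) \<and>
     indep M {} \<and>
     (\<forall>A B. indep M A \<longrightarrow> B \<subseteq> A \<longrightarrow> indep M B) \<and>
     (\<forall>A B. maximal_indep M B \<longrightarrow> indep M A \<longrightarrow> \<not> maximal_indep M A \<longrightarrow>
            (\<exists>b \<in> B - A. indep M (insert b A))) \<and>
     (\<forall>A X. indep M A \<longrightarrow> A \<subseteq> X \<longrightarrow> X \<subseteq> gset M \<longrightarrow>
            (\<exists>S. A \<subseteq> S \<and> maximal_indep_in M X S))"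

definition dual :: "'a setsys \<Rightarrow> 'a setsys" where
  "dual M = (gset M, {X. \<exists>B. basis M B \<and> X \<subseteq> gset M - B})"

definition finitarization :: "'a setsys \<Rightarrow> 'a setsys" where
  "finitarization M = (gset M, {X. X \<subseteq> gset M \<and> (\<forall>Y. Y \<subseteq> X \<longrightarrow> finite Y \<longrightarrow> indep M Y)})"

definition nearly_finitary :: "'a setsys \<Rightarrow> bool" where
  "nearly_finitary M \<longleftrightarrow>
     (\<forall>F B. basis (finitarization M) F \<longrightarrow> basis M B \<longrightarrow> B \<subseteq> F \<longrightarrow> finite (F - B))"

definition nearly_cofinitary :: "'a setsys \<Rightarrow> bool" where
  "nearly_cofinitary M \<longleftrightarrow> nearly_finitary (dual M)"

definition matroid_union :: "'a setsys \<Rightarrow> 'a setsys \<Rightarrow> 'a setsys" where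
  "matroid_union A B = (gset A \<union> gset B, {S \<union> T | S T. indep A S \<and> indep B T})"

end

(*
  Write U for the union of the dual of the finitarization with M. Unions of matroids satisfy the
  exchange axiom (this is proved with exchange paths), but extensions to bases may fail. Extending a
  base B of M to a base F of the finitarization shows that U has an independent set whose complement
  F - B is finite. By exchange, all bases of U then have complements of the same finite
  cardinality k. So the bases of the dual of U are k-sets, the exchange axiom passes to the dual
  since every extension step happens inside a finite complement, and maximal independent subsets
  exist because independent sets of the dual have at most k elements. That U itself is a matroid
  is never needed.
*)

theory Submission
  imports Defs
begin

section \<open>Exchange systems and their bases\<close>

text \<open>The fragment of the matroid axioms that unions of matroids satisfy. Existence of bases
  is not included; without a basis the last clause is vacuous.\<close>

definition exchange_system :: "'a setsys \<Rightarrow> bool" where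
  "exchange_system M \<longleftrightarrow>
     (\<forall>X. indep M X \<longrightarrow> X \<subseteq> gset M) \<and>
     (\<forall>A B. indep M A \<longrightarrow> B \<subseteq> A \<longrightarrow> indep M B) \<and>
     (\<forall>A B. basis M B \<longrightarrow> indep M A \<longrightarrow> \<not> basis M A \<longrightarrow> (\<exists>b \<in> B - A. indep M (insert b A)))"

lemma matroid_exchange_system: "matroid M \<Longrightarrow> exchange_system M"
  unfolding matroid_def exchange_system_def basis_def by (elim conjE, intro conjI; assumption)

lemma matroidI:
  assumes "exchange_system M" "indep M {}"
    and "\<And>A X. indep M A \<Longrightarrow> A \<subseteq> X \<Longrightarrow> X \<subseteq> gset M
      \<Longrightarrow> \<exists>S. A \<subseteq> S \<and> maximal_indep_in M X S"
  shows "matroid M"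
proof -
  have "\<forall>A X. indep M A \<longrightarrow> A \<subseteq> X \<longrightarrow> X \<subseteq> gset M \<longrightarrow> (\<exists>S. A \<subseteq> S \<and> maximal_indep_in M X S)"
    by (intro allI impI) (rule assms(3))
  with assms(1,2) show ?thesis
    unfolding matroid_def exchange_system_def basis_def
    by - (elim conjE, intro conjI; assumption)
qed

lemma indep_gset: "exchange_system M \<Longrightarrow> indep M X \<Longrightarrow> X \<subseteq> gset M"
  unfolding exchange_system_def by blast

lemma indep_subset: "exchange_system M \<Longrightarrow> indep M A \<Longrightarrow> B \<subseteq> A \<Longrightarrow> indep M B"
  unfolding exchange_system_def by blast

lemma basis_augment:
  assumes "exchange_system M" "basis M B" "indep M A" "\<not> basis M A"
  obtains b where "b \<in> B" "b \<notin> A" "indep M (insert b A)"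
  using assms unfolding exchange_system_def by (meson DiffD1 DiffD2)

lemma basis_indep: "basis M B \<Longrightarrow> indep M B"
  unfolding basis_def maximal_indep_def by blast

lemma basis_maximal: "basis M B \<Longrightarrow> indep M X \<Longrightarrow> B \<subseteq> X \<Longrightarrow> X = B"
  unfolding basis_def maximal_indep_def by blast

lemma not_basis_remove:
  assumes "basis M B" "e \<in> B"
  shows "\<not> basis M (B - {e})"
  using assms basis_maximal[of M "B - {e}" B] basis_indep[of M B] by blast

text \<open>Otherwise augmentation from \<open>B\<close> could only restore \<open>e\<close>, which
  would make \<open>insert y B\<close> independent against the maximality of
  \<open>B\<close>.\<close>

lemma basis_swap:
  assumes ex: "exchange_system M" and B: "basis M B" and y: "y \<notin> B"
    and i: "indep M (insert y (B - {e}))"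
  shows "basis M (insert y (B - {e}))"
proof (rule ccontr)
  assume "\<not> ?thesis"
  then obtain b where b: "b \<in> B" "b \<notin> insert y (B - {e})" "indep M (insert b (insert y (B - {e})))"
    using basis_augment[OF ex B i] by blast
  then have "insert b (insert y (B - {e})) = insert y B" by blast
  with b(3) have "indep M (insert y B)" by simp
  with basis_maximal[OF B] y show False by blast
qed

text \<open>Trading an element of \<open>B' - B\<close> for one of \<open>B - B'\<close> gives a
  basis for which both differences have shrunk by one element; induction on the finite one.\<close>

lemma basis_diff_card:
  assumes ex: "exchange_system M" and "basis M B" "basis M B'" "finite (B' - B)"
  shows "finite (B - B') \<and> card (B - B') = card (B' - B)"
  using assms(2-4)
proof (induction "card (B' - B)" arbitrary: B')
  case 0
  then have "B' \<subseteq> B" by auto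
  then have "B = B'" using basis_maximal[OF 0(3) basis_indep[OF 0(2)]] by blast
  then show ?case by simp
next
  case (Suc n)
  then obtain e where e: "e \<in> B'" "e \<notin> B" by (metis DiffD1 DiffD2 card_eq_0_iff ex_in_conv nat.distinct(1))
  obtain y where y: "y \<in> B" "y \<notin> B' - {e}" "indep M (insert y (B' - {e}))"
    using basis_augment[OF ex Suc.prems(1) _ not_basis_remove[OF Suc.prems(2) e(1)]]
      indep_subset[OF ex basis_indep[OF Suc.prems(2)]] by blast
  define C where "C = insert y (B' - {e})"
  have yB': "y \<notin> B'" using y e by blast
  have C: "basis M C" unfolding C_def by (rule basis_swap[OF ex Suc.prems(2) yB' y(3)])
  have 1: "C - B = (B' - B) - {e}" and 2: "B - B' = insert y (B - C)" "y \<notin> B - C"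
    unfolding C_def using y e yB' by auto
  have n: "n = card (C - B)" using Suc.hyps(2) Suc.prems(3) e 1 by simp
  have "finite (C - B)" using 1 Suc.prems(3) by simp
  then have "finite (B - C) \<and> card (B - C) = card (C - B)"
    using Suc.hyps(1)[OF n Suc.prems(1) C] by blast
  then show ?case using 2 n Suc.hyps(2) by simp
qed

section \<open>Extension and exchange inside a matroid\<close>

text \<open>Maximality is put in a one-element form that combines directly with augmentation. As
  \<open>X\<close> may leave the ground set, the axiom is applied to
  \<open>X \<inter> gset M\<close>.\<close>

lemma indep_extend_in:
  assumes "matroid M" "indep M A" "A \<subseteq> X"
  obtains S where "A \<subseteq> S" "S \<subseteq> X" "indep M S" "\<And>b. b \<in> X \<Longrightarrow> indep M (insert b S) \<Longrightarrow> b \<in> S"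
proof -
  have "A \<subseteq> gset M" using assms indep_gset matroid_exchange_system by blast
  then obtain S where "A \<subseteq> S" "maximal_indep_in M (X \<inter> gset M) S"
    using assms unfolding matroid_def by (meson Int_lower2 Int_subset_iff)
  then have S: "A \<subseteq> S" "S \<subseteq> X" "indep M S"
    and m: "\<And>T. indep M T \<Longrightarrow> S \<subseteq> T \<Longrightarrow> T \<subseteq> X \<inter> gset M \<Longrightarrow> T = S"
    unfolding maximal_indep_in_def by auto
  have "b \<in> S" if "b \<in> X" "indep M (insert b S)" for b
    using m[OF that(2)] that S(2) indep_gset[OF matroid_exchange_system[OF assms(1)] that(2)] by blast
  with S that show thesis by blast
qed

text \<open>A maximal independent subset of \<open>X\<close> is a basis of \<open>M\<close> here,
  because augmentation from \<open>B\<close> would stay inside \<open>X\<close>.\<close>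

lemma basis_between:
  assumes M: "matroid M" and "indep M A" "A \<subseteq> X" "basis M B" "B \<subseteq> X"
  obtains J where "basis M J" "A \<subseteq> J" "J \<subseteq> X"
proof -
  obtain S where S: "A \<subseteq> S" "S \<subseteq> X" "indep M S"
    "\<And>b. b \<in> X \<Longrightarrow> indep M (insert b S) \<Longrightarrow> b \<in> S"
    using indep_extend_in[OF assms(1-3)] by blast
  have "basis M S"
  proof (rule ccontr)
    assume "\<not> basis M S"
    then obtain b where "b \<in> B" "b \<notin> S" "indep M (insert b S)"
      using basis_augment[OF matroid_exchange_system[OF M] assms(4) S(3)] by blast
    with S(4) assms(5) show False by blast
  qed
  with S that show thesis by blast
qed

lemma basis_extend:
  assumes M: "matroid M" and "indep M A"
  obtains B where "basis M B" "A \<subseteq> B"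
proof -
  obtain S where S: "A \<subseteq> S" "indep M S" "\<And>b. indep M (insert b S) \<Longrightarrow> b \<in> S"
  proof (rule indep_extend_in[OF assms, of UNIV])
    fix S assume "A \<subseteq> S" "indep M S" "\<And>b. b \<in> UNIV \<Longrightarrow> indep M (insert b S) \<Longrightarrow> b \<in> S"
    then show thesis using that by simp
  qed simp
  have "X = S" if "indep M X" "S \<subseteq> X" for X
  proof -
    have "b \<in> S" if "b \<in> X" for b
    proof (rule S(3))
      show "indep M (insert b S)"
        by (rule indep_subset[OF matroid_exchange_system[OF M] \<open>indep M X\<close>])
          (use that \<open>S \<subseteq> X\<close> in blast)
    qed
    with \<open>S \<subseteq> X\<close> show ?thesis by blast
  qed
  with S that show thesis unfolding basis_def maximal_indep_def by blast
qed

text \<open>A basis \<open>J\<close> with \<open>A \<subseteq> J \<subseteq> insert e B\<close> has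
  \<open>J - B = {e}\<close>, so by equal differences it omits exactly one element of
  \<open>B\<close>.\<close>

lemma basis_exchange_into:
  assumes M: "matroid M" and B: "basis M B" and "e \<notin> B" "e \<in> A" "A \<subseteq> insert e B" "indep M A"
  obtains f where "f \<in> B" "f \<notin> A" "basis M (insert e (B - {f}))"
proof -
  obtain J where J: "basis M J" "A \<subseteq> J" "J \<subseteq> insert e B"
    using basis_between[OF M assms(6,5) B] by blast
  have JB: "J - B = {e}" using J assms by blast
  then have "card (B - J) = 1"
    using basis_diff_card[OF matroid_exchange_system[OF M] B J(1)] by simp
  then obtain f where f: "B - J = {f}" by (metis card_1_singletonE)
  then have "J = insert e (B - {f})" using JB by blast
  with J f that show thesis by blast
qed

text \<open>Independence in the contraction by \<open>Z\<close> does not depend on the independent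
  subset of \<open>Z\<close> chosen to test it: \<open>A\<close> spans \<open>Z\<close>, and
  \<open>C\<close> is independent over \<open>A\<close>, hence over every independent
  \<open>K\<close> in \<open>Z\<close>. A maximal extension \<open>L\<close> of \<open>K\<close> in
  \<open>Z\<close> grows to a basis \<open>J\<close> inside \<open>L \<union> (B - Z)\<close>, and
  \<open>J\<close> turns out to contain all of \<open>B - Z\<close>.\<close>

lemma contraction_indep:
  assumes M: "matroid M" and AC: "indep M (A \<union> C)" and "A \<subseteq> Z" "C \<inter> Z = {}"
    and sp: "\<And>e. e \<in> Z - A \<Longrightarrow> \<not> indep M (insert e A)"
    and K: "indep M K" "K \<subseteq> Z"
  shows "indep M (K \<union> C)"
proof -
  note ex = matroid_exchange_system[OF M]
  obtain B where B: "basis M B" "A \<union> C \<subseteq> B" using basis_extend[OF M AC] by blast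
  obtain L where L: "K \<subseteq> L" "L \<subseteq> Z" "indep M L"
    "\<And>b. b \<in> Z \<Longrightarrow> indep M (insert b L) \<Longrightarrow> b \<in> L"
    using indep_extend_in[OF M K] by blast
  obtain J where J: "L \<subseteq> J" "J \<subseteq> L \<union> (B - Z)" "indep M J"
    "\<And>b. b \<in> L \<union> (B - Z) \<Longrightarrow> indep M (insert b J) \<Longrightarrow> b \<in> J"
    using indep_extend_in[OF M L(3), of "L \<union> (B - Z)"] by blast
  have Jb: "basis M J"
  proof (rule ccontr)
    assume "\<not> basis M J"
    then obtain b where b: "b \<in> B" "b \<notin> J" "indep M (insert b J)"
      using basis_augment[OF ex B(1) J(3)] by blast
    have "indep M (insert b L)" using indep_subset[OF ex b(3)] J(1) by blast
    then show False using b J(1,4) L(4) by blast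
  qed
  \<comment> \<open>If \<open>c\<close> were missing, refilling \<open>B - {c}\<close> from
    \<open>J\<close> would need an element of \<open>Z - A\<close> independent over
    \<open>A\<close>, against \<open>sp\<close>.\<close>
  have "c \<in> J" if c: "c \<in> B - Z" for c
  proof (rule ccontr)
    assume cJ: "c \<notin> J"
    obtain b where b: "b \<in> J" "b \<notin> B - {c}" "indep M (insert b (B - {c}))"
      using basis_augment[OF ex Jb _ not_basis_remove[OF B(1)]] c
        indep_subset[OF ex basis_indep[OF B(1)]] by blast
    have bZ: "b \<in> Z - A" using b cJ J(2) L(2) B(2) by blast
    have "insert b A \<subseteq> insert b (B - {c})" using B(2) c assms(3) by blast
    then have "indep M (insert b A)" by (rule indep_subset[OF ex b(3)])
    with sp bZ show False by blast
  qed
  then have "K \<union> C \<subseteq> J" using L(1) J(1) B(2) assms(4) by blast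
  then show ?thesis using indep_subset[OF ex J(3)] by blast
qed

section \<open>The finitarization is a matroid\<close>

lemma gset_finitarization [simp]: "gset (finitarization M) = gset M"
  unfolding finitarization_def gset_def by simp

lemma indep_finitarization:
  "indep (finitarization M) X \<longleftrightarrow> X \<subseteq> gset M \<and> (\<forall>Y. Y \<subseteq> X \<longrightarrow> finite Y \<longrightarrow> indep M Y)"
  unfolding finitarization_def indep_def by simp

text \<open>Some \<open>x\<close> outside \<open>B\<close> can be added to \<open>A\<close>, while
  \<open>insert x B\<close> has a finite dependent subset \<open>Q\<close>. If no element of
  \<open>B - A\<close> can be added to \<open>A\<close>, each is spanned by a finite subset of
  \<open>A\<close>, so a finite subset of \<open>A\<close> spans \<open>Q - {x}\<close>. Contraction
  then makes \<open>Q\<close> independent.\<close>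

lemma basis_finitarization_exchange:
  assumes M: "matroid M" and B: "basis (finitarization M) B"
    and A: "indep (finitarization M) A" "\<not> basis (finitarization M) A"
  shows "\<exists>b \<in> B - A. indep (finitarization M) (insert b A)"
proof (rule ccontr)
  assume no: "\<not> ?thesis"
  note ex = matroid_exchange_system[OF M]
  obtain X where X: "indep (finitarization M) X" "A \<subseteq> X" "X \<noteq> A"
    using A unfolding basis_def maximal_indep_def by blast
  then obtain x where x: "x \<in> X" "x \<notin> A" by blast
  have Ax: "indep (finitarization M) (insert x A)" using X x unfolding indep_finitarization by blast
  have xB: "x \<notin> B" using no Ax x by blast
  have xg: "x \<in> gset M" using Ax unfolding indep_finitarization by blast
  have "\<not> indep (finitarization M) (insert x B)" using basis_maximal[OF B] xB by blast
  then obtain Q where Q: "Q \<subseteq> insert x B" "finite Q" "\<not> indep M Q"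
    using basis_indep[OF B] xg unfolding indep_finitarization by blast
  have BQ: "indep M (Q - {x})" using basis_indep[OF B] Q unfolding indep_finitarization by blast
  have "\<exists>W. W \<subseteq> A \<and> finite W \<and> \<not> indep M (insert b W)" if b: "b \<in> B - A" for b
  proof -
    have "b \<in> gset M" using b basis_indep[OF B] unfolding indep_finitarization by blast
    then have sub: "insert b A \<subseteq> gset M" using A(1) unfolding indep_finitarization by blast
    have bA: "\<not> indep (finitarization M) (insert b A)" using no b by blast
    obtain Y where Y: "Y \<subseteq> insert b A" "finite Y" "\<not> indep M Y"
      using bA sub unfolding indep_finitarization by blast
    have "Y \<subseteq> insert b (Y - {b})" by blast
    then have "\<not> indep M (insert b (Y - {b}))" using Y(3) indep_subset[OF ex] by blast
    then show ?thesis using Y by (intro exI[of _ "Y - {b}"]) blast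
  qed
  then obtain W where W: "\<And>b. b \<in> B - A \<Longrightarrow> W b \<subseteq> A \<and> finite (W b) \<and> \<not> indep M (insert b (W b))"
    by metis
  \<comment> \<open>Only the finitely many elements of \<open>Q\<close> have to be spanned, so
    finitely many of the sets \<open>W b\<close> suffice.\<close>
  define A0 where "A0 = (Q \<inter> A) \<union> (\<Union>b \<in> Q \<inter> (B - A). W b)"
  have A0: "A0 \<subseteq> A" "finite A0" unfolding A0_def using W Q(2) by auto
  have "indep M (A0 \<union> {x})" using Ax A0 unfolding indep_finitarization
    by (metis Un_insert_right boolean_algebra.disj_zero_right finite_insert insert_mono)
  moreover have "\<not> indep M (insert e A0)" if e: "e \<in> (A0 \<union> (Q - {x})) - A0" for e
  proof -
    have "e \<in> Q \<inter> (B - A)" using e Q(1) unfolding A0_def by blast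
    moreover from this have "insert e (W e) \<subseteq> insert e A0" unfolding A0_def by blast
    ultimately show ?thesis using W indep_subset[OF ex] by blast
  qed
  \<comment> \<open>\<open>{x}\<close> is independent over \<open>A0\<close>, which spans
    \<open>A0 \<union> (Q - {x})\<close>; now \<open>A0\<close> is traded for
    \<open>Q - {x}\<close>.\<close>
  ultimately have "indep M ((Q - {x}) \<union> {x})"
    using contraction_indep[OF M, of A0 "{x}" "A0 \<union> (Q - {x})" "Q - {x}"] BQ A0(1) x(2) by blast
  then show False using Q(3) indep_subset[OF ex] by blast
qed

text \<open>A finite subset of the union of a chain lies in one member, so independence passes to
  such unions and Zorn's lemma gives the maximal sets.\<close>

lemma matroid_finitarization:
  assumes M: "matroid M"
  shows "matroid (finitarization M)"
proof -
  note ex = matroid_exchange_system[OF M]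
  have e: "indep M {}" using M unfolding matroid_def by blast
  have "\<exists>S. A \<subseteq> S \<and> maximal_indep_in (finitarization M) X S"
    if A: "indep (finitarization M) A" "A \<subseteq> X" "X \<subseteq> gset M" for A X
  proof -
    define F where "F = {S. A \<subseteq> S \<and> S \<subseteq> X \<and> indep (finitarization M) S}"
    have "\<exists>S\<in>F. \<forall>T\<in>F. S \<subseteq> T \<longrightarrow> T = S"
    proof (rule subset_Zorn_nonempty)
      show "F \<noteq> {}" unfolding F_def using A by blast
      fix C assume C: "C \<noteq> {}" "subset.chain F C"
      have CF: "C \<subseteq> F" using C unfolding subset.chain_def by blast
      have "indep M Y" if Y: "Y \<subseteq> \<Union>C" "finite Y" for Y
      proof -
        obtain c where "c \<in> C" "Y \<subseteq> c"
          using finite_subset_Union_chain[OF Y(2,1) C] by blast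
        then show ?thesis using CF Y unfolding F_def indep_finitarization by blast
      qed
      moreover have "\<Union>C \<subseteq> X" using CF unfolding F_def by blast
      moreover have "A \<subseteq> \<Union>C" using CF C(1) unfolding F_def by blast
      moreover from calculation have "\<Union>C \<subseteq> gset M" using A(3) by blast
      ultimately show "\<Union>C \<in> F" unfolding F_def indep_finitarization by blast
    qed
    then obtain S where S: "A \<subseteq> S" "S \<subseteq> X" "indep (finitarization M) S"
      and m: "\<forall>T\<in>F. S \<subseteq> T \<longrightarrow> T = S" unfolding F_def by blast
    have "T = S" if "indep (finitarization M) T" "S \<subseteq> T" "T \<subseteq> X" for T
      using m that S(1) unfolding F_def by blast
    with S show ?thesis unfolding maximal_indep_in_def by blast
  qed
  moreover have "indep (finitarization M) {}" using e unfolding indep_finitarization by simp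
  moreover have "indep (finitarization M) B" if "indep (finitarization M) A" "B \<subseteq> A" for A B
    using that unfolding indep_finitarization by blast
  ultimately show ?thesis
    unfolding matroid_def gset_finitarization
    using basis_finitarization_exchange[OF M] unfolding basis_def
    by (simp add: indep_finitarization)
qed

section \<open>Duality\<close>

lemma indep_dual: "indep (dual M) X \<longleftrightarrow> (\<exists>B. basis M B \<and> X \<subseteq> gset M - B)"
  unfolding dual_def indep_def by simp

lemma gset_dual [simp]: "gset (dual M) = gset M"
  unfolding dual_def gset_def by simp

lemma basis_dual:
  assumes ex: "exchange_system M"
  shows "basis (dual M) D \<longleftrightarrow> (\<exists>B. basis M B \<and> D = gset M - B)"
proof
  assume D: "basis (dual M) D"
  then obtain B where B: "basis M B" "D \<subseteq> gset M - B"
    using basis_indep indep_dual by metis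
  then have "indep (dual M) (gset M - B)" unfolding indep_dual by blast
  with B basis_maximal[OF D] show "\<exists>B. basis M B \<and> D = gset M - B" by blast
next
  assume "\<exists>B. basis M B \<and> D = gset M - B"
  then obtain B where B: "basis M B" "D = gset M - B" by blast
  have "X = D" if X: "indep (dual M) X" "D \<subseteq> X" for X
  proof -
    obtain B' where B': "basis M B'" "X \<subseteq> gset M - B'" using X unfolding indep_dual by blast
    have "B' \<subseteq> B" using B B' X(2) indep_gset[OF ex basis_indep[OF B'(1)]] by blast
    then have "B = B'" using basis_maximal[OF B'(1) basis_indep[OF B(1)]] by blast
    with B B' X(2) show ?thesis by blast
  qed
  moreover have "indep (dual M) D" using B unfolding indep_dual by blast
  ultimately show "basis (dual M) D" unfolding basis_def maximal_indep_def by blast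
qed

text \<open>The condition \<open>between\<close> is dual exchange after complementation, with
  \<open>X\<close> the complement of \<open>A\<close>: a basis \<open>J\<close> inside
  \<open>X\<close> that contains \<open>X \<inter> B\<close> leaves some \<open>b\<close> of
  \<open>X\<close> uncovered, and \<open>b\<close> avoids \<open>B\<close>. Matroids and cofinite
  systems satisfy this condition for different reasons.\<close>

lemma exchange_system_dual:
  assumes ex: "exchange_system M"
    and between: "\<And>B B' X. basis M B \<Longrightarrow> basis M B' \<Longrightarrow> B' \<subseteq> X \<Longrightarrow> X \<subseteq> gset M
      \<Longrightarrow> \<exists>J. basis M J \<and> X \<inter> B \<subseteq> J \<and> J \<subseteq> X"
  shows "exchange_system (dual M)"
proof -
  have "\<exists>b\<in>D - A. indep (dual M) (insert b A)"
    if D: "basis (dual M) D" and A: "indep (dual M) A" "\<not> basis (dual M) A" for D A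
  proof -
    obtain B where B: "basis M B" "D = gset M - B" using D basis_dual[OF ex] by blast
    obtain B' where B': "basis M B'" "A \<subseteq> gset M - B'" using A(1) unfolding indep_dual by blast
    have B'g: "B' \<subseteq> gset M - A" using B' indep_gset[OF ex basis_indep] by blast
    obtain J where J: "basis M J" "(gset M - A) \<inter> B \<subseteq> J" "J \<subseteq> gset M - A"
      using between[OF B(1) B'(1) B'g] by blast
    have "J \<noteq> gset M - A"
    proof
      assume "J = gset M - A"
      then have "A = gset M - J" using B'(2) by blast
      then show False using A(2) J(1) basis_dual[OF ex] by blast
    qed
    then obtain b where b: "b \<in> gset M - A" "b \<notin> J" using J(3) by blast
    then have "insert b A \<subseteq> gset M - J" using J(3) B'(2) by blast
    then have "indep (dual M) (insert b A)" using J(1) unfolding indep_dual by blast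
    moreover have "b \<in> D - A" using b J(2) B(2) by blast
    ultimately show ?thesis by blast
  qed
  moreover have "indep (dual M) B" if "indep (dual M) A" "B \<subseteq> A" for A B
    using that unfolding indep_dual by blast
  moreover have "X \<subseteq> gset M" if "indep (dual M) X" for X
    using that unfolding indep_dual by blast
  ultimately show ?thesis unfolding exchange_system_def gset_dual by blast
qed

text \<open>For the maximal sets: the complement of a basis has a maximal trace on \<open>X\<close>
  once the basis contains a maximal independent subset of \<open>gset M - X\<close>.\<close>

lemma matroid_dual:
  assumes M: "matroid M"
  shows "matroid (dual M)"
proof -
  note ex = matroid_exchange_system[OF M]
  have "exchange_system (dual M)"
  proof (rule exchange_system_dual[OF ex])
    fix B B' X assume "basis M B" "basis M B'" "B' \<subseteq> X" "X \<subseteq> gset M"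
    then show "\<exists>J. basis M J \<and> X \<inter> B \<subseteq> J \<and> J \<subseteq> X"
      using basis_between[OF M, of "X \<inter> B" X B'] indep_subset[OF ex basis_indep, of B "X \<inter> B"]
      by (metis Int_lower1 Int_lower2)
  qed
  moreover have "indep (dual M) {}"
  proof -
    have "indep M {}" using M unfolding matroid_def by blast
    then show ?thesis using basis_extend[OF M] indep_dual by (metis empty_subsetI)
  qed
  moreover have "\<exists>S. A \<subseteq> S \<and> maximal_indep_in (dual M) X S"
    if A: "indep (dual M) A" "A \<subseteq> X" "X \<subseteq> gset M" for A X
  proof -
    obtain B' where B': "basis M B'" "A \<subseteq> gset M - B'" using A(1) unfolding indep_dual by blast
    have B'A: "B' \<subseteq> gset M - A" using B' indep_gset[OF ex basis_indep] by blast
    have e: "indep M {}" using M unfolding matroid_def by blast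
    define Z where "Z = gset M - X"
    obtain C where C: "C \<subseteq> Z" "indep M C"
      "\<And>b. b \<in> Z \<Longrightarrow> indep M (insert b C) \<Longrightarrow> b \<in> C"
    proof (rule indep_extend_in[OF M e empty_subsetI, of Z])
      fix C assume "C \<subseteq> Z" "indep M C" "\<And>b. b \<in> Z \<Longrightarrow> indep M (insert b C) \<Longrightarrow> b \<in> C"
      then show thesis by (rule that)
    qed
    have "C \<subseteq> gset M - A" using C(1) A(2) unfolding Z_def by blast
    then obtain B where B: "basis M B" "C \<subseteq> B" "B \<subseteq> gset M - A"
      using basis_between[OF M C(2) _ B'(1) B'A] by blast
    \<comment> \<open>A larger \<open>T\<close> contains some \<open>t\<close> of \<open>B\<close>.
      Refilling \<open>B - {t}\<close> from a basis that avoids \<open>T\<close> brings in a new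
      element of \<open>Z\<close>, contradicting the maximality of \<open>C\<close> in
      \<open>Z\<close>.\<close>
    have "T = X - B" if T: "indep (dual M) T" "X - B \<subseteq> T" "T \<subseteq> X" for T
    proof (rule ccontr)
      assume "T \<noteq> X - B"
      then obtain t where t: "t \<in> T" "t \<in> B" "t \<in> X" using T by blast
      obtain B2 where B2: "basis M B2" "T \<subseteq> gset M - B2" using T(1) unfolding indep_dual by blast
      obtain b where b: "b \<in> B2" "b \<notin> B - {t}" "indep M (insert b (B - {t}))"
        using basis_augment[OF ex B2(1) _ not_basis_remove[OF B(1) t(2)]]
          indep_subset[OF ex basis_indep[OF B(1)]] by blast
      have bB: "b \<notin> B" using b t B2(2) by blast
      have "b \<in> Z" unfolding Z_def using bB b(1) B2 T(2) indep_gset[OF ex basis_indep[OF B2(1)]] by blast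
      moreover have "insert b C \<subseteq> insert b (B - {t})" using B(2) C(1) t(3) unfolding Z_def by blast
      then have "indep M (insert b C)" by (rule indep_subset[OF ex b(3)])
      ultimately show False using C(3) B(2) bB by blast
    qed
    moreover have "indep (dual M) (X - B)" using B(1) A(3) unfolding indep_dual by blast
    moreover have "A \<subseteq> X - B" using A(2) B(3) by blast
    ultimately show ?thesis unfolding maximal_indep_in_def by blast
  qed
  ultimately show ?thesis
    by (intro matroidI) auto
qed

section \<open>Exchange systems with a cofinite independent set\<close>

text \<open>The two complements share \<open>gset U - B - B'\<close> and otherwise consist of
  \<open>B - B'\<close> and \<open>B' - B\<close>, which are equinumerous.\<close>

lemma exchange_system_basis_cofinite:
  assumes ex: "exchange_system U" and B: "basis U B" and B': "basis U B'"
    and fin: "finite (gset U - B)"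
  shows "finite (gset U - B') \<and> card (gset U - B') = card (gset U - B)"
proof -
  have g: "B \<subseteq> gset U" "B' \<subseteq> gset U" using indep_gset[OF ex basis_indep] B B' by blast+
  then have "finite (B' - B)" using fin by (meson Diff_mono finite_subset order_refl)
  then have d: "finite (B - B')" "card (B - B') = card (B' - B)"
    using basis_diff_card[OF ex B B'] by auto
  have 1: "gset U - B' = (gset U - B - B') \<union> (B - B')" "gset U - B = (gset U - B - B') \<union> (B' - B)"
    using g by auto
  have f: "finite (gset U - B - B')" using fin by blast
  have "card (gset U - B') = card (gset U - B - B') + card (B - B')"
    by (subst 1(1), rule card_Un_disjoint) (use f d in auto)
  moreover have "card (gset U - B) = card (gset U - B - B') + card (B' - B)"
    by (subst 1(2), rule card_Un_disjoint) (use f \<open>finite (B' - B)\<close> in auto)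
  moreover have "finite (gset U - B')" by (subst 1(1)) (use f d in auto)
  ultimately show ?thesis using d by simp
qed

text \<open>Stands in for \<open>basis_between\<close> when maximal subsets are not guaranteed: each
  augmentation from \<open>B\<close> shrinks a finite complement, so the process stops.\<close>

lemma cofinite_basis_between:
  assumes ex: "exchange_system U" and "basis U B" "indep U A" "finite (gset U - A)"
  shows "\<exists>J. basis U J \<and> A \<subseteq> J \<and> J \<subseteq> A \<union> B"
  using assms(3,4)
proof (induction "card (gset U - A)" arbitrary: A rule: less_induct)
  case less
  show ?case
  proof (cases "basis U A")
    case False
    then obtain b where b: "b \<in> B" "b \<notin> A" "indep U (insert b A)"
      using basis_augment[OF ex assms(2) less.prems(1)] by blast
    have "gset U - insert b A \<subset> gset U - A" using b indep_gset[OF ex b(3)] by blast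
    then have "card (gset U - insert b A) < card (gset U - A)" "finite (gset U - insert b A)"
      using less.prems(2) by (auto intro: psubset_card_mono)
    then obtain J where "basis U J" "insert b A \<subseteq> J" "J \<subseteq> insert b A \<union> B"
      using less.hyps[OF _ b(3)] by blast
    with b show ?thesis by blast
  qed auto
qed

lemma cofinite_indep_extends_to_basis:
  assumes ex: "exchange_system U" and "indep U A" "finite (gset U - A)"
  shows "\<exists>J. basis U J \<and> A \<subseteq> J"
  using assms(2,3)
proof (induction "card (gset U - A)" arbitrary: A rule: less_induct)
  case less
  show ?case
  proof (cases "basis U A")
    case False
    then obtain X where X: "indep U X" "A \<subset> X"
      using less.prems(1) unfolding basis_def maximal_indep_def by blast
    have "gset U - X \<subset> gset U - A" using X indep_gset[OF ex X(1)] by blast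
    then have "card (gset U - X) < card (gset U - A)" "finite (gset U - X)"
      using less.prems(2) by (auto intro: psubset_card_mono finite_subset)
    then show ?thesis using less.hyps[OF _ X(1)] X(2) by blast
  qed auto
qed

lemma matroid_dual_of_cofinite:
  assumes ex: "exchange_system U" and B0: "indep U B0" "finite (gset U - B0)"
  shows "matroid (dual U)"
proof -
  obtain B1 where B1: "basis U B1" "B0 \<subseteq> B1"
    using cofinite_indep_extends_to_basis[OF ex B0] by blast
  have fB1: "finite (gset U - B1)" using B0(2) B1(2) by (meson Diff_mono finite_subset order_refl)
  note cof = exchange_system_basis_cofinite[OF ex B1(1) _ fB1]
  define k where "k = card (gset U - B1)"
  have "exchange_system (dual U)"
  proof (rule exchange_system_dual[OF ex])
    fix B B' X assume a: "basis U B" "basis U B'" "B' \<subseteq> X" "X \<subseteq> gset U"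
    have "indep U (X \<inter> B)" using indep_subset[OF ex basis_indep[OF a(1)]] by blast
    \<comment> \<open>Both \<open>B\<close> and \<open>X\<close>, which contains \<open>B'\<close>,
      are cofinite, so their intersection is as well.\<close>
    moreover have "gset U - (X \<inter> B) \<subseteq> (gset U - B') \<union> (gset U - B)" using a(3) by blast
    then have "finite (gset U - (X \<inter> B))" using cof a by (meson finite_UnI finite_subset)
    ultimately show "\<exists>J. basis U J \<and> X \<inter> B \<subseteq> J \<and> J \<subseteq> X"
      using cofinite_basis_between[OF ex a(2)] a(3) by (meson Int_lower1 Un_least order_trans)
  qed
  moreover have "indep (dual U) {}" using B1 unfolding indep_dual by blast
  moreover have "\<exists>S. A \<subseteq> S \<and> maximal_indep_in (dual U) X S"
    if A: "indep (dual U) A" "A \<subseteq> X" for A X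
  proof -
    have bd: "finite S \<and> card S \<le> k" if S: "indep (dual U) S" for S
      using S cof unfolding indep_dual k_def by (metis card_mono finite_subset)
    have "\<exists>S. (A \<subseteq> S \<and> S \<subseteq> X \<and> indep (dual U) S)
        \<and> (\<forall>T. A \<subseteq> T \<and> T \<subseteq> X \<and> indep (dual U) T \<longrightarrow> card T \<le> card S)"
      \<comment> \<open>Cardinalities are at most \<open>k\<close>, hence strictly below
        \<open>Suc k\<close>. A candidate of greatest cardinality is maximal under inclusion because
        all candidates are finite.\<close>
      by (rule ex_has_greatest_nat[of _ A _ "Suc k"]) (use A bd in \<open>auto simp: less_Suc_eq_le\<close>)
    then obtain S where S: "A \<subseteq> S" "S \<subseteq> X" "indep (dual U) S"
      and m: "\<forall>T. A \<subseteq> T \<and> T \<subseteq> X \<and> indep (dual U) T \<longrightarrow> card T \<le> card S" by blast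
    have "T = S" if T: "indep (dual U) T" "S \<subseteq> T" "T \<subseteq> X" for T
    proof -
      have "card T \<le> card S" using m T S(1) by blast
      then show ?thesis using card_seteq[of T S] bd[OF T(1)] T(2) by simp
    qed
    with S show ?thesis unfolding maximal_indep_in_def by blast
  qed
  ultimately show ?thesis
    by (intro matroidI) auto
qed

section \<open>Exchange paths\<close>

text \<open>Exchanging \<open>e\<close> into a basis above \<open>insert p S\<close> drops some
  \<open>g\<close> outside \<open>S - {f}\<close>. It must lie in \<open>S\<close>, as otherwise
  \<open>insert e S\<close> would be independent; hence \<open>g = f\<close> and \<open>p\<close>
  survives.\<close>

lemma indep_exchange_commute:
  assumes M: "matroid M" and p: "indep M (insert p S)" and "\<not> indep M (insert e S)"
    and f: "f \<in> S" "indep M (insert e (S - {f}))"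
  shows "indep M (insert e (insert p S - {f}))"
proof -
  note ex = matroid_exchange_system[OF M]
  obtain B where B: "basis M B" "insert p S \<subseteq> B" using basis_extend[OF M p] by blast
  have "e \<notin> B"
    using assms(3) B(2) indep_subset[OF ex basis_indep[OF B(1)], of "insert e S"] by blast
  then obtain g where g: "g \<in> B" "g \<notin> insert e (S - {f})" "basis M (insert e (B - {g}))"
    using basis_exchange_into[OF M B(1) _ _ _ f(2)] B(2) by blast
  note sub = indep_subset[OF ex basis_indep[OF g(3)]]
  have "\<not> insert e S \<subseteq> insert e (B - {g})" using sub assms(3) by metis
  then have "g \<in> S" using B(2) by blast
  then have "insert e (insert p S - {f}) \<subseteq> insert e (B - {g})"
    using g B(2) by blast
  then show ?thesis by (rule sub)
qed

text \<open>If \<open>insert e (S \<inter> Z)\<close> were independent, exchanging \<open>e\<close>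
  into a basis above \<open>S\<close> would drop some \<open>g\<close> outside
  \<open>S \<inter> Z\<close>: either an element of \<open>S - Z\<close>, excluded by
  \<open>no\<close>, or one outside \<open>S\<close>, making \<open>insert e S\<close>
  independent.\<close>

lemma spans_of_no_exchange:
  assumes M: "matroid M" and S: "indep M S" and "\<not> indep M (insert e S)"
    and no: "\<And>f. f \<in> S - Z \<Longrightarrow> \<not> indep M (insert e (S - {f}))"
  shows "\<not> indep M (insert e (S \<inter> Z))"
proof
  assume i: "indep M (insert e (S \<inter> Z))"
  note ex = matroid_exchange_system[OF M]
  obtain B where B: "basis M B" "S \<subseteq> B" using basis_extend[OF M S] by blast
  have "e \<notin> B"
    using assms(3) B(2) indep_subset[OF ex basis_indep[OF B(1)], of "insert e S"] by blast
  then obtain g where g: "g \<in> B" "g \<notin> insert e (S \<inter> Z)" "basis M (insert e (B - {g}))"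
    using basis_exchange_into[OF M B(1) _ _ _ i] B(2) by blast
  note sub = indep_subset[OF ex basis_indep[OF g(3)]]
  show False
  proof (cases "g \<in> S")
    case True
    then show False using sub[of "insert e (S - {g})"] no[of g] g B(2) by blast
  next
    case False
    then show False using sub[of "insert e S"] assms(3) B(2) by blast
  qed
qed

text \<open>The starting points of exchange paths. Such an element may already lie on one side,
  provided the other side can take it.\<close>

definition free_elem :: "'a setsys \<Rightarrow> 'a setsys \<Rightarrow> 'a set \<Rightarrow> 'a set \<Rightarrow> 'a \<Rightarrow> bool" where
  "free_elem P N S T e \<longleftrightarrow> e \<notin> S \<and> indep P (insert e S) \<or> e \<notin> T \<and> indep N (insert e T)"

text \<open>An edge from f to e: once f has moved to the other side, e can take its place.\<close>

definition exchange_edge :: "'a setsys \<Rightarrow> 'a setsys \<Rightarrow> 'a set \<Rightarrow> 'a set \<Rightarrow> 'a \<Rightarrow> 'a \<Rightarrow> bool" where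
  "exchange_edge P N S T f e \<longleftrightarrow>
     f \<in> S \<and> e \<notin> S \<and> indep P (insert e (S - {f})) \<or>
     f \<in> T \<and> e \<notin> T \<and> indep N (insert e (T - {f}))"

lemma free_elem_commute: "free_elem P N S T = free_elem N P T S"
  by (intro ext) (auto simp: free_elem_def)

lemma exchange_edge_commute: "exchange_edge P N S T = exchange_edge N P T S"
  by (intro ext) (auto simp: exchange_edge_def)

lemma gset_union [simp]: "gset (matroid_union P N) = gset P \<union> gset N"
  unfolding matroid_union_def gset_def by simp

lemma indep_union: "indep (matroid_union P N) X \<longleftrightarrow> (\<exists>S T. X = S \<union> T \<and> indep P S \<and> indep N T)"
  unfolding matroid_union_def indep_def by simp

lemma indep_unionI: "indep P S \<Longrightarrow> indep N T \<Longrightarrow> indep (matroid_union P N) (S \<union> T)"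
  unfolding indep_union by (intro exI[of _ S] exI[of _ T] conjI refl)

text \<open>Edges through \<open>P\<close> survive the growth of \<open>S\<close> by
  \<open>indep_exchange_commute\<close>, since \<open>e\<close> is not free; edges through
  \<open>N\<close> survive because \<open>T\<close> only shrinks.\<close>

lemma exchange_edge_shift:
  assumes P: "matroid P" and N: "matroid N"
    and p: "p \<notin> S" "indep P (insert p S)"
    and "exchange_edge P N S T f e" "\<not> free_elem P N S T e" "f \<noteq> p" "e \<noteq> p"
  shows "exchange_edge P N (insert p S) (T - {p}) f e"
  using assms(5) unfolding exchange_edge_def
proof (elim disjE conjE)
  assume "f \<in> S" "e \<notin> S" "indep P (insert e (S - {f}))"
  moreover from this have "indep P (insert e (insert p S - {f}))"
    using indep_exchange_commute[OF P p(2)] assms(6) unfolding free_elem_def by blast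
  ultimately show "f \<in> insert p S \<and> e \<notin> insert p S \<and> indep P (insert e (insert p S - {f})) \<or>
    f \<in> T - {p} \<and> e \<notin> T - {p} \<and> indep N (insert e (T - {p} - {f}))" using assms(8) by blast
next
  assume "f \<in> T" "e \<notin> T" "indep N (insert e (T - {f}))"
  moreover have "insert e (T - {p} - {f}) \<subseteq> insert e (T - {f})" by blast
  ultimately have "indep N (insert e (T - {p} - {f}))"
    using indep_subset[OF matroid_exchange_system[OF N]] by blast
  with \<open>f \<in> T\<close> \<open>e \<notin> T\<close>
  show "f \<in> insert p S \<and> e \<notin> insert p S \<and> indep P (insert e (insert p S - {f})) \<or>
    f \<in> T - {p} \<and> e \<notin> T - {p} \<and> indep N (insert e (T - {p} - {f}))" using assms(7) by blast
qed

text \<open>Induction on the length of the path: if no later vertex is free, moving the first vertex to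
  the other side keeps all later edges intact and makes the second vertex free; otherwise the path
  can be shortened.\<close>

lemma exchange_path_augment:
  assumes P: "matroid P" and N: "matroid N"
    and "indep P S" "indep N T" "S \<inter> T = {}" "S \<union> T = X"
    and "xs \<noteq> []" "free_elem P N S T (hd xs)" "successively (exchange_edge P N S T) xs"
    and "last xs \<notin> X"
  shows "indep (matroid_union P N) (insert (last xs) X)"
  using assms(3-10)
proof (induction xs arbitrary: S T rule: length_induct)
  case (1 xs)
  note IH = 1(1)[rule_format]
  note S = 1(2) and T = 1(3) and disj = 1(4) and X = 1(5) and ne = 1(6) and fr = 1(7)
    and path = 1(8) and lst = 1(9)
  obtain p ys where xs: "xs = p # ys" using ne by (cases xs) auto
  show ?case
  proof (cases ys)
    case Nil
    show ?thesis
      using fr S T unfolding xs Nil free_elem_def indep_union X[symmetric]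
      by auto (metis Un_insert_left Un_insert_right)+
  next
    case (Cons q zs)
    have lastys: "last xs = last ys" using xs Cons by simp
    have pathys: "successively (exchange_edge P N S T) ys" and pq: "exchange_edge P N S T p q"
      using path unfolding xs Cons by auto
    show ?thesis
    proof (cases "\<exists>r\<in>set ys. free_elem P N S T r")
      case True
      then obtain r us vs where r: "ys = us @ r # vs" "free_elem P N S T r"
        by (meson split_list)
      have "successively (exchange_edge P N S T) (r # vs)"
        using pathys unfolding r(1) by (simp add: successively_append_iff)
      then have "indep (matroid_union P N) (insert (last (r # vs)) X)"
        using IH[of "r # vs" S T] S T disj X r lst xs by simp
      then show ?thesis using xs r(1) by simp
    next
      case False
      \<comment> \<open>\<open>p\<close> is free and no vertex of \<open>ys\<close> is, so the path
        does not return to \<open>p\<close>, as shifting its edges requires.\<close>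
      have pnot: "p \<notin> set ys" using False fr xs by auto
      have shift: "successively (exchange_edge P N S' T') ys"
        if "\<And>f e. exchange_edge P N S T f e \<Longrightarrow> \<not> free_elem P N S T e \<Longrightarrow> f \<noteq> p \<Longrightarrow> e \<noteq> p
           \<Longrightarrow> exchange_edge P N S' T' f e" for S' T'
        by (rule successively_mono[OF pathys]) (use that pnot False in blast)
      have "p \<in> S \<or> p \<in> T" using pq unfolding exchange_edge_def by blast
      then show ?thesis
      proof
        assume pT: "p \<in> T"
        then have pS: "p \<notin> S" "indep P (insert p S)"
          using disj fr unfolding xs free_elem_def by auto
        have iT: "indep N (T - {p})" using indep_subset[OF matroid_exchange_system[OF N] T] by blast
        have q: "free_elem P N (insert p S) (T - {p}) q"
          using pq pS(1) unfolding exchange_edge_def free_elem_def by blast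
        have "indep (matroid_union P N) (insert (last ys) X)"
          by (rule IH[of ys "insert p S" "T - {p}"])
            (use xs Cons pT pS iT q disj X lst shift[OF exchange_edge_shift[OF P N pS]] in auto)
        then show ?thesis using lastys by simp
      next
        assume pS: "p \<in> S"
        then have pT: "p \<notin> T" "indep N (insert p T)"
          using disj fr unfolding xs free_elem_def by auto
        have iS: "indep P (S - {p})" using indep_subset[OF matroid_exchange_system[OF P] S] by blast
        have q: "free_elem P N (S - {p}) (insert p T) q"
          using pq pT(1) unfolding exchange_edge_def free_elem_def by blast
        have "successively (exchange_edge P N (S - {p}) (insert p T)) ys"
          by (rule shift, subst exchange_edge_commute, rule exchange_edge_shift[OF N P pT])
            (auto simp: exchange_edge_commute[of N P] free_elem_commute[of N P])
        then have "indep (matroid_union P N) (insert (last ys) X)"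
          by (intro IH[of ys "S - {p}" "insert p T"])
            (use xs Cons pT pS iS q disj X lst in auto)
        then show ?thesis using lastys by simp
      qed
    qed
  qed
qed

section \<open>Exchange for unions\<close>

text \<open>Everything outside \<open>X\<close> that an exchange path reaches from a free element
  can be added to \<open>X\<close>. If \<open>Y\<close> offered no such element, it could be
  enlarged by rearranging it inside the reachable set.\<close>

lemma exchange_system_union:
  assumes P: "matroid P" and N: "matroid N"
  shows "exchange_system (matroid_union P N)"
proof -
  let ?U = "matroid_union P N"
  note exP = matroid_exchange_system[OF P] and exN = matroid_exchange_system[OF N]
  have sub: "indep ?U B" if AB: "indep ?U A" "B \<subseteq> A" for A B
  proof -
    obtain S T where "A = S \<union> T" "indep P S" "indep N T" using AB(1) unfolding indep_union by blast
    then have "B = (S \<inter> B) \<union> (T \<inter> B)" "indep P (S \<inter> B)" "indep N (T \<inter> B)"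
      using AB(2) indep_subset[OF exP, of S] indep_subset[OF exN, of T] by blast+
    then show ?thesis using indep_union by metis
  qed
  have "\<exists>b\<in>Y - X. indep ?U (insert b X)"
    if Y: "basis ?U Y" and X: "indep ?U X" "\<not> basis ?U X" for X Y
  proof -
    obtain X' where X': "indep ?U X'" "X \<subset> X'"
      using X unfolding basis_def maximal_indep_def by blast
    then obtain x where x: "x \<in> X'" "x \<notin> X" by blast
    have "indep ?U (insert x X)" using sub[OF X'(1)] X'(2) x by blast
    then obtain S T' where ST': "insert x X = S \<union> T'" "indep P S" "indep N T'"
      using indep_union by metis
    \<comment> \<open>Exchange paths are set up for disjoint sides.\<close>
    define T where "T = T' - S"
    have "indep N T" unfolding T_def by (rule indep_subset[OF exN ST'(3)]) blast
    with ST' have ST: "insert x X = S \<union> T" "indep P S" "indep N T" "S \<inter> T = {}"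
      unfolding T_def by auto
    define S0 T0 where "S0 = S - {x}" and "T0 = T - {x}"
    have "indep P S0" unfolding S0_def by (rule indep_subset[OF exP ST(2)]) blast
    moreover have "indep N T0" unfolding T0_def by (rule indep_subset[OF exN ST(3)]) blast
    moreover have "S0 \<inter> T0 = {}" unfolding S0_def T0_def using ST(4) by blast
    moreover have "S0 \<union> T0 = X" unfolding S0_def T0_def using ST(1) x(2) by blast
    ultimately have S0: "indep P S0" "indep N T0" "S0 \<inter> T0 = {}" "S0 \<union> T0 = X" by blast+
    have "insert x S0 = S \<or> insert x T0 = T" unfolding S0_def T0_def using ST(1) by blast
    then have frx: "free_elem P N S0 T0 x" unfolding free_elem_def using ST x S0(4) by auto
    \<comment> \<open>The reachable set is closed under edges by construction, so any exchange that
      brings in an element outside \<open>R\<close> also removes one outside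
      \<open>R\<close>.\<close>
    define R where "R = {e. \<exists>p. free_elem P N S0 T0 p \<and> (exchange_edge P N S0 T0)\<^sup>*\<^sup>* p e}"
    have xR: "x \<in> R" unfolding R_def using frx by blast
    have freeR: "e \<in> R" if "free_elem P N S0 T0 e" for e using that unfolding R_def by blast
    have stepR: "e \<in> R" if "f \<in> R" "exchange_edge P N S0 T0 f e" for e f
      using that unfolding R_def by (auto intro: rtranclp.rtrancl_into_rtrancl)
    have aug: "indep ?U (insert v X)" if v: "v \<in> R" "v \<notin> X" for v
    proof -
      obtain p where p: "free_elem P N S0 T0 p" "(exchange_edge P N S0 T0)\<^sup>*\<^sup>* p v"
        using v unfolding R_def by blast
      from p(2) obtain xs where "xs \<noteq> []" "hd xs = p" "last xs = v"
        "successively (exchange_edge P N S0 T0) xs"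
      proof (induction arbitrary: thesis rule: rtranclp_induct)
        case base
        show ?case by (rule base[of "[p]"]) auto
      next
        case (step y z)
        obtain xs where "xs \<noteq> []" "hd xs = p" "last xs = y"
          "successively (exchange_edge P N S0 T0) xs" using step.IH by blast
        then show ?case using step.hyps
          by (intro step.prems[of "xs @ [z]"]) (auto simp: successively_append_iff)
      qed
      then show ?thesis using exchange_path_augment[OF P N S0, of xs] p(1) v(2) by simp
    qed
    show ?thesis
    proof (rule ccontr)
      assume "\<not> ?thesis"
      then have no: "Y \<inter> R \<subseteq> X" using aug by blast
      \<comment> \<open>No edge leaves R, so S0 - R and T0 - R span the complement of R; hence inside R the
        decomposition of Y can be replaced by that of X + x, and this contradicts the
        maximality of Y.\<close>
      obtain S2 T2 where Y2: "Y = S2 \<union> T2" "indep P S2" "indep N T2"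
        using basis_indep[OF Y] indep_union by metis
      have "indep P ((S2 - R) \<union> (S \<inter> R))"
      proof (rule contraction_indep[OF P, of "S0 \<inter> - R" _ "- R"])
        have "(S0 \<inter> - R) \<union> (S \<inter> R) \<subseteq> S" unfolding S0_def by blast
        then show "indep P ((S0 \<inter> - R) \<union> (S \<inter> R))" using indep_subset[OF exP ST(2)] by blast
        show "\<not> indep P (insert e (S0 \<inter> - R))" if e: "e \<in> - R - (S0 \<inter> - R)" for e
        proof (rule spans_of_no_exchange[OF P S0(1)])
          show "\<not> indep P (insert e S0)" using freeR[of e] e unfolding free_elem_def by blast
          show "\<not> indep P (insert e (S0 - {f}))" if "f \<in> S0 - (- R)" for f
            using stepR[of f e] that e unfolding exchange_edge_def by blast
        qed
      qed (use indep_subset[OF exP Y2(2)] in auto)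
      moreover have "indep N ((T2 - R) \<union> (T \<inter> R))"
      proof (rule contraction_indep[OF N, of "T0 \<inter> - R" _ "- R"])
        have "(T0 \<inter> - R) \<union> (T \<inter> R) \<subseteq> T" unfolding T0_def by blast
        then show "indep N ((T0 \<inter> - R) \<union> (T \<inter> R))" using indep_subset[OF exN ST(3)] by blast
        show "\<not> indep N (insert e (T0 \<inter> - R))" if e: "e \<in> - R - (T0 \<inter> - R)" for e
        proof (rule spans_of_no_exchange[OF N S0(2)])
          show "\<not> indep N (insert e T0)" using freeR[of e] e unfolding free_elem_def by blast
          show "\<not> indep N (insert e (T0 - {f}))" if "f \<in> T0 - (- R)" for f
            using stepR[of f e] that e unfolding exchange_edge_def by blast
        qed
      qed (use indep_subset[OF exN Y2(3)] in auto)
      ultimately have "indep ?U (((S2 - R) \<union> (S \<inter> R)) \<union> ((T2 - R) \<union> (T \<inter> R)))"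
        by (rule indep_unionI)
      \<comment> \<open>Outside \<open>R\<close> the old parts of \<open>Y\<close> cover it; inside
        \<open>R\<close> both \<open>x\<close> and \<open>Y \<inter> R\<close>, a subset of
        \<open>X\<close>, are covered by \<open>S\<close> and \<open>T\<close>.\<close>
      moreover have "insert x Y \<subseteq> ((S2 - R) \<union> (S \<inter> R)) \<union> ((T2 - R) \<union> (T \<inter> R))"
        using no Y2(1) ST(1) xR by blast
      ultimately have "indep ?U (insert x Y)" using sub by blast
      then have "x \<in> Y" using basis_maximal[OF Y] by blast
      then show False using no xR x(2) by blast
    qed
  qed
  moreover have "X \<subseteq> gset ?U" if "indep ?U X" for X
    using that indep_gset[OF exP] indep_gset[OF exN] unfolding gset_union indep_union by blast
  ultimately show ?thesis using sub unfolding exchange_system_def by blast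
qed

section \<open>A cofinite independent set in the union\<close>

theorem theorem3p4p3:
  fixes M :: "'a setsys"
  assumes "matroid M" and "nearly_finitary M" and "nearly_cofinitary M"
  shows "matroid (dual (matroid_union (dual (finitarization M)) M))"
proof -
  let ?F = "finitarization M"
  let ?U = "matroid_union (dual ?F) M"
  note ex = matroid_exchange_system[OF assms(1)]
  have F: "matroid ?F" by (rule matroid_finitarization[OF assms(1)])
  have gU: "gset ?U = gset M" by simp
  have "indep M {}" using assms(1) unfolding matroid_def by blast
  then obtain B where B: "basis M B" using basis_extend[OF assms(1)] by blast
  have "indep ?F B"
    using indep_gset[OF ex basis_indep[OF B]] indep_subset[OF ex basis_indep[OF B]]
    unfolding indep_finitarization by simp
  then obtain G where G: "basis ?F G" "B \<subseteq> G" using basis_extend[OF F] by blast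
  have "finite (G - B)" using assms(2) B G unfolding nearly_finitary_def by blast
  \<comment> \<open>The cofinite set joins the basis \<open>B\<close> of \<open>M\<close> to the
    complement of \<open>G\<close>, which is a basis of \<open>dual ?F\<close>; it misses only
    elements of \<open>G - B\<close>.\<close>
  moreover have "gset ?U - ((gset M - G) \<union> B) \<subseteq> G - B" unfolding gU by blast
  ultimately have "finite (gset ?U - ((gset M - G) \<union> B))" by (rule rev_finite_subset)
  moreover have "indep (dual ?F) (gset M - G)" using G(1) unfolding indep_dual by auto
  then have "indep ?U ((gset M - G) \<union> B)" by (rule indep_unionI[OF _ basis_indep[OF B]])
  ultimately show ?thesis
    by (intro matroid_dual_of_cofinite[OF exchange_system_union[OF matroid_dual[OF F] assms(1)]])
qed

end
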